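(* For every finite nonempty set $A$ let $\Phi_A:\mathbb P_A\to\mathbb P_A$ be the linear map defined on posets $\mathcal A$ with underlying set $A$ by $$\Phi_A(\mathcal A)=\sum_{\mathcal A'\preceq\mathcal A}\mathcal A',$$ the sum running over all posets $\mathcal A'$ on $A$ finer than $\mathcal A$. Then $\Phi=(\Phi_A)_A$ is an automorphism of the linear species $\mathbb P$, and for any pair $(\mathcal A,\mathcal B)$ of finite nonempty posets with disjoint underlying sets and any $a\in\mathcal A$, $$\Phi(\mathcal A\bullet_a\mathcal B)=\Phi(\mathcal A)\circ_a\Phi(\mathcal B).$$
   Context: Fix a field $\mathbf k$. The linear species $\mathbb P$ assigns to a finite nonempty set $A$ the $\mathbf k$-vector space $\mathbb P_A$ freely generated by all partial orders on $A$; bijections act by relabelling. A poset $(A,\leqslant)$ is finer than $(A,\le)$, written $(A,\leqslant)\preceq(A,\le)$, if $x\leqslant y\Rightarrow x\le y$ for all $x,y\in A$. For disjoint $A,B$ and $a\in A$ put $A\sqcup_a B:=(A\setminus\{a\})\sqcup B$. Definition of $\bullet_a$: for posets $\mathcal A=(A,\le_A)$, $\mathcal B=(B,\le_B)$, $\mathcal A\bullet_a\mathcal B$ is $A\sqcup_a B$ with $x\le y$ iff ($x,y\in B$, $x\le_By$) or ($x,y\in A\setminus\{a\}$, $x\le_Ay$) or ($x\in A\setminus\{a\}$, $y\in B$, $x\le_Aa$) or ($x\in B$, $y\in A\setminus\{a\}$, $a\le_Ay$). Definition of $\circ_a$: a subset $B$ of a poset $(P,\le)$ is convex if $x,y\in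 B$, $x\le z\le y$ imply $z\in B$. For a nonempty convex $B$, the quotient poset $(P,\le)/B$ is the set $(P\setminus B)\sqcup\{B\}$ with the partial order $\leqslant$: $\{B\}\leqslant\{B\}$; for $y\in P\setminus B$, $\{B\}\leqslant y$ iff $b\le y$ for some $b\in B$; for $x\in P\setminus B$, $x\leqslant\{B\}$ iff $x\le b$ for some $b\in B$; for $x,y\in P\setminus B$, $x\leqslant y$ iff $x\le y$ or there exist $b,b'\in B$ with $x\le b$, $b'\le y$. Let $\Omega(\mathcal A,a,\mathcal B)$ be the set of partial orders $\le$ on $A\sqcup_aB$ such that $\le$ restricted to $B$ is $\le_B$, $B$ is convex in $(A\sqcup_aB,\le)$, and $(A\sqcup_aB,\le)/B$ equals $\mathcal A$ when the point $\{B\}$ is identified with $a$. Then $\mathcal A\circ_a\mathcal B:=\sum_{\le\in\Omega(\mathcal A,a,\mathcal B)}(A\sqcup_aB,\le)$, extended bilinearly to $\mathbb P_A\otimes\mathbb P_B\to\mathbb P_{A\sqcup_aB}$. *)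

theory Defs
  imports Complex_Main "HOL-Library.Poly_Mapping"
begin

section \<open>Linear species\<close>

text \<open>
  A (positive) linear species is a functor from finite nonempty sets with bijections to
  vector spaces.  The finite sets are the finite subsets of an arbitrary type 'a, and the value
  at \<open>A\<close> is a subspace \<open>V A\<close> of one ambient vector space.  Bijections \<open>A \<rightarrow> B\<close> are HOL functions
  \<open>\<sigma>\<close> with \<^term>\<open>bij_betw \<sigma> A B\<close>, of which only the values on \<open>A\<close> may matter (\<open>act_cong\<close>).
\<close>

definition linear_map_between ::
  "('k \<Rightarrow> 'v \<Rightarrow> 'v) \<Rightarrow> 'v set \<Rightarrow> 'v set \<Rightarrow> ('v::ab_group_add \<Rightarrow> 'v) \<Rightarrow> bool" where
  "linear_map_between s V W f \<longleftrightarrow>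
     f ` V \<subseteq> W \<and>
     (\<forall>x\<in>V. \<forall>y\<in>V. f (x + y) = f x + f y) \<and>
     (\<forall>c. \<forall>x\<in>V. f (s c x) = s c (f x))"

locale linear_species = vector_space scale
  for scale :: "'k::field \<Rightarrow> 'v::ab_group_add \<Rightarrow> 'v" +
  fixes V :: "'a set \<Rightarrow> 'v set"
    and act :: "'a set \<Rightarrow> ('a \<Rightarrow> 'a) \<Rightarrow> 'v \<Rightarrow> 'v"
  assumes subspace_V: "\<lbrakk>finite A; A \<noteq> {}\<rbrakk> \<Longrightarrow> subspace (V A)"
    and act_linear: "\<lbrakk>finite A; A \<noteq> {}; bij_betw \<sigma> A B\<rbrakk>
          \<Longrightarrow> linear_map_between scale (V A) (V B) (act A \<sigma>)"
    and act_cong: "\<lbrakk>finite A; A \<noteq> {}; bij_betw \<sigma> A B; \<And>x. x \<in> A \<Longrightarrow> \<sigma> x = \<tau> x; v \<in> V A\<rbrakk>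
          \<Longrightarrow> act A \<sigma> v = act A \<tau> v"
    and act_id: "\<lbrakk>finite A; A \<noteq> {}; v \<in> V A\<rbrakk> \<Longrightarrow> act A id v = v"
    and act_comp: "\<lbrakk>finite A; A \<noteq> {}; bij_betw \<sigma> A B; bij_betw \<tau> B C; v \<in> V A\<rbrakk>
          \<Longrightarrow> act A (\<tau> \<circ> \<sigma>) v = act B \<tau> (act A \<sigma> v)"
begin

definition endomorphism :: "('a set \<Rightarrow> 'v \<Rightarrow> 'v) \<Rightarrow> bool" where
  "endomorphism F \<longleftrightarrow>
     (\<forall>A. finite A \<and> A \<noteq> {} \<longrightarrow> linear_map_between scale (V A) (V A) (F A)) \<and>
     (\<forall>A B \<sigma>. finite A \<and> A \<noteq> {} \<and> bij_betw \<sigma> A B \<longrightarrow>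
        (\<forall>v\<in>V A. F B (act A \<sigma> v) = act A \<sigma> (F A v)))"

definition automorphism :: "('a set \<Rightarrow> 'v \<Rightarrow> 'v) \<Rightarrow> bool" where
  "automorphism F \<longleftrightarrow>
     endomorphism F \<and>
     (\<exists>G. endomorphism G \<and>
        (\<forall>A. finite A \<and> A \<noteq> {} \<longrightarrow> (\<forall>v\<in>V A. G A (F A v) = v \<and> F A (G A v) = v)))"

end


section \<open>The linear species of posets\<close>

definition pm_scale :: "'k::field \<Rightarrow> ('b \<Rightarrow>\<^sub>0 'k) \<Rightarrow> ('b \<Rightarrow>\<^sub>0 'k)" where
  "pm_scale c p = Poly_Mapping.map ((*) c) p"

definition basis_vec :: "'b \<Rightarrow> ('b \<Rightarrow>\<^sub>0 'k::field)" where
  "basis_vec b = Poly_Mapping.single b 1"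

definition linear_extension :: "('b \<Rightarrow> ('c \<Rightarrow>\<^sub>0 'k)) \<Rightarrow> ('b \<Rightarrow>\<^sub>0 'k::field) \<Rightarrow> ('c \<Rightarrow>\<^sub>0 'k)" where
  "linear_extension f p =
     (\<Sum>b\<in>Poly_Mapping.keys p. pm_scale (Poly_Mapping.lookup p b) (f b))"

definition bilinear_extension ::
  "('b \<Rightarrow> 'c \<Rightarrow> ('d \<Rightarrow>\<^sub>0 'k)) \<Rightarrow> ('b \<Rightarrow>\<^sub>0 'k::field) \<Rightarrow> ('c \<Rightarrow>\<^sub>0 'k) \<Rightarrow> ('d \<Rightarrow>\<^sub>0 'k)" where
  "bilinear_extension f p q = linear_extension (\<lambda>b. linear_extension (f b) q) p"

text \<open>A poset on \<open>A\<close> is a relation \<open>r\<close> with \<^term>\<open>partial_order_on A r\<close>; in particular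
  \<^term>\<open>r \<subseteq> A \<times> A\<close>.\<close>

definition poset_space :: "'a set \<Rightarrow> ('a rel \<Rightarrow>\<^sub>0 'k::field) set" where
  "poset_space A = {p. \<forall>r\<in>Poly_Mapping.keys p. partial_order_on A r}"

definition relabel :: "('a \<Rightarrow> 'b) \<Rightarrow> 'a rel \<Rightarrow> 'b rel" where
  "relabel \<sigma> r = map_prod \<sigma> \<sigma> ` r"

definition poset_act ::
  "'a set \<Rightarrow> ('a \<Rightarrow> 'a) \<Rightarrow> ('a rel \<Rightarrow>\<^sub>0 'k::field) \<Rightarrow> ('a rel \<Rightarrow>\<^sub>0 'k)" where
  "poset_act A \<sigma> = linear_extension (\<lambda>r. basis_vec (relabel \<sigma> r))"

definition finer :: "'a set \<Rightarrow> 'a rel \<Rightarrow> 'a rel \<Rightarrow> bool" where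
  "finer A r' r \<longleftrightarrow> (\<forall>x\<in>A. \<forall>y\<in>A. (x, y) \<in> r' \<longrightarrow> (x, y) \<in> r)"

definition Phi :: "'a set \<Rightarrow> ('a rel \<Rightarrow>\<^sub>0 'k::field) \<Rightarrow> ('a rel \<Rightarrow>\<^sub>0 'k)" where
  "Phi A = linear_extension
     (\<lambda>r. \<Sum>r' | partial_order_on A r' \<and> finer A r' r. basis_vec r')"


section \<open>The two partial compositions\<close>

definition graft_set :: "'a set \<Rightarrow> 'a \<Rightarrow> 'a set \<Rightarrow> 'a set" where
  "graft_set A a B = (A - {a}) \<union> B"

definition bullet :: "'a set \<Rightarrow> 'a rel \<Rightarrow> 'a \<Rightarrow> 'a set \<Rightarrow> 'a rel \<Rightarrow> 'a rel" where
  "bullet A rA a B rB =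
     {(x, y). (x \<in> B \<and> y \<in> B \<and> (x, y) \<in> rB) \<or>
              (x \<in> A - {a} \<and> y \<in> A - {a} \<and> (x, y) \<in> rA) \<or>
              (x \<in> A - {a} \<and> y \<in> B \<and> (x, a) \<in> rA) \<or>
              (x \<in> B \<and> y \<in> A - {a} \<and> (a, y) \<in> rA)}"

definition convex_in :: "'a set \<Rightarrow> 'a rel \<Rightarrow> 'a set \<Rightarrow> bool" where
  "convex_in P r B \<longleftrightarrow>
     B \<subseteq> P \<and> (\<forall>x\<in>B. \<forall>y\<in>B. \<forall>z\<in>P. (x, z) \<in> r \<and> (z, y) \<in> r \<longrightarrow> z \<in> B)"

text \<open>The set \<open>(P \<setminus> B) \<squnion> {B}\<close> is encoded by options: \<open>None\<close> is the new point \<open>{B}\<close>.\<close>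

definition quotient_order :: "'a set \<Rightarrow> 'a rel \<Rightarrow> 'a set \<Rightarrow> 'a option rel" where
  "quotient_order P r B =
     {(None, None)} \<union>
     {(None, Some y) | y. y \<in> P - B \<and> (\<exists>b\<in>B. (b, y) \<in> r)} \<union>
     {(Some x, None) | x. x \<in> P - B \<and> (\<exists>b\<in>B. (x, b) \<in> r)} \<union>
     {(Some x, Some y) | x y. x \<in> P - B \<and> y \<in> P - B \<and>
        ((x, y) \<in> r \<or> (\<exists>b\<in>B. \<exists>b'\<in>B. (x, b) \<in> r \<and> (b', y) \<in> r))}"

definition Omega :: "'a set \<Rightarrow> 'a rel \<Rightarrow> 'a \<Rightarrow> 'a set \<Rightarrow> 'a rel \<Rightarrow> 'a rel set" where
  "Omega A rA a B rB =
     {r. partial_order_on (graft_set A a B) r \<and>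
         r \<inter> (B \<times> B) = rB \<and>
         convex_in (graft_set A a B) r B \<and>
         relabel (case_option a id) (quotient_order (graft_set A a B) r B) = rA}"

definition circ :: "'a set \<Rightarrow> 'a \<Rightarrow> 'a set \<Rightarrow>
    ('a rel \<Rightarrow>\<^sub>0 'k::field) \<Rightarrow> ('a rel \<Rightarrow>\<^sub>0 'k) \<Rightarrow> ('a rel \<Rightarrow>\<^sub>0 'k)" where
  "circ A a B = bilinear_extension (\<lambda>rA rB. \<Sum>r\<in>Omega A rA a B rB. basis_vec r)"


section \<open>Well-definedness\<close>

lemma lookup_pm_scale [simp]:
  "Poly_Mapping.lookup (pm_scale c p) b = c * Poly_Mapping.lookup p b"
  by (simp add: pm_scale_def Poly_Mapping.map.rep_eq when_def)

interpretation pm: vector_space "pm_scale :: 'k::field \<Rightarrow> ('b \<Rightarrow>\<^sub>0 'k) \<Rightarrow> _"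
  by unfold_locales (auto intro!: poly_mapping_eqI simp: lookup_add algebra_simps)

lemma linear_extension_superset:
  assumes "finite S" "Poly_Mapping.keys p \<subseteq> S"
  shows "linear_extension f p = (\<Sum>b\<in>S. pm_scale (Poly_Mapping.lookup p b) (f b))"
  unfolding linear_extension_def
  by (rule sum.mono_neutral_left) (use assms in \<open>auto simp: in_keys_iff\<close>)

lemma linear_extension_add:
  "linear_extension f (p + q) = linear_extension f p + linear_extension f q"
proof -
  let ?S = "Poly_Mapping.keys p \<union> Poly_Mapping.keys q"
  have S: "finite ?S" by simp
  show ?thesis
    by (subst (1 2 3) linear_extension_superset[OF S])
       (auto simp: keys_add lookup_add pm.scale_left_distrib sum.distrib)
qed

lemma linear_extension_scale:
  "linear_extension f (pm_scale c p) = pm_scale c (linear_extension f p)"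
proof -
  have "Poly_Mapping.keys (pm_scale c p) \<subseteq> Poly_Mapping.keys p"
    by (auto simp: in_keys_iff)
  from linear_extension_superset[OF finite_keys this] show ?thesis
    by (simp add: linear_extension_def pm.scale_sum_right)
qed

lemma linear_extension_basis_vec [simp]: "linear_extension f (basis_vec b) = f b"
  by (simp add: linear_extension_def basis_vec_def)

lemma subspace_poset_space: "pm.subspace (poset_space A)"
  unfolding pm.subspace_def poset_space_def
  by (fastforce simp: in_keys_iff lookup_add)

lemma basis_vec_in_poset_space [simp]:
  "basis_vec r \<in> poset_space A \<longleftrightarrow> partial_order_on A r"
  by (simp add: basis_vec_def poset_space_def)

lemma linear_extension_in_poset_space:
  assumes "\<And>r. r \<in> Poly_Mapping.keys p \<Longrightarrow> f r \<in> poset_space A"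
  shows "linear_extension f p \<in> poset_space A"
  unfolding linear_extension_def
  by (intro pm.subspace_sum pm.subspace_scale subspace_poset_space assms)

lemma linear_extension_comp:
  fixes p :: "'b \<Rightarrow>\<^sub>0 'k::field" and g :: "'b \<Rightarrow> 'c" and f :: "'c \<Rightarrow> ('d \<Rightarrow>\<^sub>0 'k)"
  shows "linear_extension f (linear_extension (\<lambda>b. basis_vec (g b)) p)
     = linear_extension (\<lambda>b. f (g b)) p"
proof -
  have sum: "linear_extension f (\<Sum>b\<in>S. h b) = (\<Sum>b\<in>S. linear_extension f (h b))"
    if "finite S" for S and h :: "'b \<Rightarrow> 'c \<Rightarrow>\<^sub>0 'k"
    using that
    by (induction S) (auto simp: linear_extension_add linear_extension_def[of f 0])
  show ?thesis
    unfolding linear_extension_def[of _ p]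
    by (simp add: sum linear_extension_scale)
qed

lemma partial_order_on_relabel:
  assumes r: "partial_order_on A r" and \<sigma>: "bij_betw \<sigma> A B"
  shows "partial_order_on B (relabel \<sigma> r)"
proof -
  have sub: "r \<subseteq> A \<times> A" and "refl_on A r" and tr: "trans r" and as: "antisym r"
    using partial_order_onD[OF r] by auto
  have inj: "inj_on \<sigma> A" and B: "B = \<sigma> ` A"
    using \<sigma> by (auto simp: bij_betw_def)
  have 1: "relabel \<sigma> r \<subseteq> B \<times> B"
    using sub by (auto simp: relabel_def B)
  have 2: "refl_on B (relabel \<sigma> r)"
    using \<open>refl_on A r\<close> by (force simp: relabel_def refl_on_def B)
  have 3: "trans (relabel \<sigma> r)"
  proof (rule transI)
    fix x y z assume "(x, y) \<in> relabel \<sigma> r" "(y, z) \<in> relabel \<sigma> r"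
    then obtain u v v' w where h: "(u, v) \<in> r" "(v', w) \<in> r" "x = \<sigma> u" "y = \<sigma> v" "y = \<sigma> v'" "z = \<sigma> w"
      by (auto simp: relabel_def)
    then have "v = v'"
      using inj sub by (metis inj_onD mem_Sigma_iff subsetD)
    then have "(u, w) \<in> r"
      using h tr by (auto dest: transD)
    then show "(x, z) \<in> relabel \<sigma> r"
      using h by (force simp: relabel_def)
  qed
  have 4: "antisym (relabel \<sigma> r)"
  proof (rule antisymI)
    fix x y assume "(x, y) \<in> relabel \<sigma> r" "(y, x) \<in> relabel \<sigma> r"
    then obtain u v u' v' where h: "(u, v) \<in> r" "(v', u') \<in> r"
        "x = \<sigma> u" "y = \<sigma> v" "y = \<sigma> v'" "x = \<sigma> u'"
      by (auto simp: relabel_def)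
    then have "v = v'" "u = u'"
      using inj sub by (metis inj_onD mem_Sigma_iff subsetD)+
    then show "x = y"
      using h as by (auto dest: antisymD)
  qed
  show ?thesis
    using 1 2 3 4 by (simp add: partial_order_on_def preorder_on_def)
qed

lemma linear_extension_cong:
  "(\<And>r. r \<in> Poly_Mapping.keys p \<Longrightarrow> f r = g r) \<Longrightarrow> linear_extension f p = linear_extension g p"
  by (simp add: linear_extension_def)

lemma linear_extension_id: "linear_extension basis_vec p = p"
proof (rule poly_mapping_eqI)
  fix b
  show "Poly_Mapping.lookup (linear_extension basis_vec p) b = Poly_Mapping.lookup p b"
    by (cases "b \<in> Poly_Mapping.keys p")
       (auto simp: linear_extension_def basis_vec_def lookup_sum lookup_single when_def
         in_keys_iff if_distrib sum.delta cong: if_cong)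
qed

interpretation poset_species:
  linear_species "pm_scale :: 'k::field \<Rightarrow> ('a rel \<Rightarrow>\<^sub>0 'k) \<Rightarrow> _" poset_space poset_act
proof (unfold_locales, goal_cases)
  case (1 A)
  show ?case by (rule subspace_poset_space)
next
  case (2 A \<sigma> B)
  then have "poset_act A \<sigma> v \<in> poset_space B" if "v \<in> poset_space A" for v :: "'a rel \<Rightarrow>\<^sub>0 'k"
    using that unfolding poset_act_def
    by (intro linear_extension_in_poset_space)
       (auto simp: poset_space_def[of A] intro: partial_order_on_relabel)
  then show ?case
    by (auto simp: linear_map_between_def poset_act_def
        linear_extension_add linear_extension_scale)
next
  case (3 A \<sigma> B \<tau> v)
  have "relabel \<sigma> r = relabel \<tau> r" if "r \<in> Poly_Mapping.keys v" for r
  proof -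
    have "r \<subseteq> A \<times> A"
      using 3 that by (auto simp: poset_space_def dest!: partial_order_onD)
    then show ?thesis
      unfolding relabel_def using 3 by (intro image_cong) auto
  qed
  then show ?case
    unfolding poset_act_def by (intro linear_extension_cong) auto
next
  case (4 A v)
  have "relabel id = (id :: 'a rel \<Rightarrow> _)"
    by (auto simp: relabel_def fun_eq_iff prod.map_id0)
  then show ?case
    by (simp add: poset_act_def linear_extension_id)
next
  case (5 A \<sigma> B \<tau> C v)
  have "relabel (\<tau> \<circ> \<sigma>) r = relabel \<tau> (relabel \<sigma> r)" for r :: "'a rel"
    by (force simp: relabel_def)
  then show ?case
    by (simp add: poset_act_def linear_extension_comp)
qed

lemma partial_order_on_bullet:
  assumes rA: "partial_order_on A rA" and rB: "partial_order_on B rB"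
    and dis: "A \<inter> B = {}" and a: "a \<in> A"
  shows "partial_order_on (graft_set A a B) (bullet A rA a B rB)"
proof -
  have A: "refl_on A rA" "trans rA" "antisym rA" and B: "refl_on B rB" "trans rB" "antisym rB"
    using partial_order_onD[OF rA] partial_order_onD[OF rB] by auto
  have "bullet A rA a B rB \<subseteq> graft_set A a B \<times> graft_set A a B"
    by (auto simp: bullet_def graft_set_def)
  moreover have "refl_on (graft_set A a B) (bullet A rA a B rB)"
    using A B by (auto simp: bullet_def graft_set_def refl_on_def)
  moreover have "trans (bullet A rA a B rB)"
  proof (rule transI)
    fix x y z
    assume "(x, y) \<in> bullet A rA a B rB" "(y, z) \<in> bullet A rA a B rB"
    moreover have "(a, a) \<in> rA" using A a by (auto simp: refl_on_def)
    ultimately show "(x, z) \<in> bullet A rA a B rB"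
      using dis transD[OF A(2), of x y z] transD[OF A(2), of x a z] transD[OF A(2), of x y a]
        transD[OF A(2), of a y z] transD[OF B(2), of x y z]
        antisymD[OF A(3), of a y]
      by (cases "x \<in> B"; cases "y \<in> B"; cases "z \<in> B") (auto simp: bullet_def)
  qed
  moreover have "antisym (bullet A rA a B rB)"
  proof (rule antisymI)
    fix x y
    assume "(x, y) \<in> bullet A rA a B rB" "(y, x) \<in> bullet A rA a B rB"
    then show "x = y"
      using dis antisymD[OF A(3), of x y] antisymD[OF A(3), of x a] antisymD[OF A(3), of a y]
        antisymD[OF B(3), of x y]
      by (auto simp: bullet_def)
  qed
  ultimately show ?thesis
    by (simp add: partial_order_on_def preorder_on_def)
qed

end

theory Submission
  imports Defs
begin

text \<open>
  The matrix of \<open>\<Phi>\<close> in the basis of posets is unitriangular for the order by fineness, so \<open>\<Phi>\<close> is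
  bijective on each finite set, and the inverse of a bijective endomorphism is an endomorphism.
  For the compositions, a partial order \<open>r\<close> finer than \<open>\<A> \<bullet>\<^sub>a \<B>\<close> automatically has \<open>B\<close> convex
  (a point outside \<open>B\<close> between two points of \<open>B\<close> would be both above and below \<open>a\<close> in \<open>\<A>\<close>).
  Hence it lies in \<open>\<Omega>(\<A>', a, \<B>')\<close> for exactly one pair, namely the quotient \<open>\<A>'\<close> of \<open>r\<close> by \<open>B\<close> and
  the restriction \<open>\<B>'\<close> of \<open>r\<close> to \<open>B\<close>, and fineness of \<open>r\<close> is equivalent to \<open>\<A>' \<preceq> \<A>\<close> and
  \<open>\<B>' \<preceq> \<B>\<close>.
\<close>

section \<open>Bijective endomorphisms of linear species\<close>

context linear_species
begin

text \<open>The componentwise inverse is linear and commutes with relabelling because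
  \<open>F\<close> is and does: \<open>F\<close> sends both sides of each required identity to the
  same vector, and \<open>F\<close> is injective on the component.\<close>

lemma automorphism_if_bij_betw:
  assumes F: "endomorphism F"
    and bij: "\<And>A. finite A \<Longrightarrow> A \<noteq> {} \<Longrightarrow> bij_betw (F A) (V A) (V A)"
  shows "automorphism F"
proof -
  define G where "G A = inv_into (V A) (F A)" for A
  have GF: "G A (F A v) = v" and FG: "F A (G A v) = v" and GV: "G A v \<in> V A"
    if "finite A" "A \<noteq> {}" "v \<in> V A" for A v
    using bij[OF that(1,2)] that(3) unfolding G_def
    by (auto simp: bij_betw_inv_into_left bij_betw_inv_into_right
        intro: bij_betw_apply[OF bij_betw_inv_into])
  have lin: "linear_map_between scale (V A) (V A) (G A)" if A: "finite A" "A \<noteq> {}" for A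
  proof -
    have sub: "subspace (V A)" using subspace_V A .
    have FA: "linear_map_between scale (V A) (V A) (F A)"
      using F A by (auto simp: endomorphism_def)
    have "G A (x + y) = G A x + G A y" if "x \<in> V A" "y \<in> V A" for x y
    proof -
      have "F A (G A x + G A y) = x + y"
        using FA that GV A FG by (simp add: linear_map_between_def)
      moreover have "G A x + G A y \<in> V A"
        using that GV A sub by (simp add: subspace_add)
      ultimately show ?thesis using GF[OF A] by metis
    qed
    moreover have "G A (scale c x) = scale c (G A x)" if "x \<in> V A" for c x
    proof -
      have "F A (scale c (G A x)) = scale c x"
        using FA that GV A FG by (simp add: linear_map_between_def)
      moreover have "scale c (G A x) \<in> V A"
        using that GV A sub by (simp add: subspace_scale)
      ultimately show ?thesis using GF[OF A] by metis
    qed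
    ultimately show ?thesis
      using GV[OF A] by (simp add: linear_map_between_def image_subset_iff)
  qed
  have "G B (act A \<sigma> v) = act A \<sigma> (G A v)"
    if A: "finite A" "A \<noteq> {}" and \<sigma>: "bij_betw \<sigma> A B" and v: "v \<in> V A" for A B \<sigma> v
  proof -
    have B: "finite B" "B \<noteq> {}"
      using A \<sigma> bij_betw_finite bij_betw_empty2 by blast+
    have "F B (act A \<sigma> (G A v)) = act A \<sigma> (F A (G A v))"
      using F A \<sigma> GV[OF A v] by (simp add: endomorphism_def)
    then have "F B (act A \<sigma> (G A v)) = act A \<sigma> v"
      using FG A v by simp
    moreover have "act A \<sigma> (G A v) \<in> V B"
      using act_linear[OF A \<sigma>] GV[OF A v] by (auto simp: linear_map_between_def)
    ultimately show ?thesis using GF[OF B] by metis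
  qed
  with lin have "endomorphism G"
    by (simp add: endomorphism_def)
  with F GF FG show ?thesis
    unfolding automorphism_def by blast
qed

end


section \<open>Linear extensions\<close>

lemma linear_extension_zero [simp]: "linear_extension f 0 = 0"
  by (simp add: linear_extension_def)

lemma linear_extension_sum:
  "linear_extension f (\<Sum>i\<in>S. h i) = (\<Sum>i\<in>S. linear_extension f (h i))"
  by (induction S rule: infinite_finite_induct) (simp_all add: linear_extension_add)

lemma linear_extension_linear_extension:
  "linear_extension f (linear_extension g p) = linear_extension (\<lambda>b. linear_extension f (g b)) p"
  by (simp add: linear_extension_def[of _ p] linear_extension_sum linear_extension_scale)

lemma linear_extension_diff:
  "linear_extension f (p - q) = linear_extension f p - linear_extension f q"
  by (metis add_diff_cancel diff_add_cancel linear_extension_add)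

lemma lookup_basis_vec: "Poly_Mapping.lookup (basis_vec b) c = (if b = c then 1 else 0)"
  by (simp add: basis_vec_def lookup_single when_def)


section \<open>Finer orders\<close>

text \<open>A partial order on \<open>A\<close> lies inside \<open>A \<times> A\<close>, so fineness
  becomes plain inclusion of relations; cardinality arguments and induction over subsets then apply
  to it.\<close>

definition finer_orders :: "'a set \<Rightarrow> 'a rel \<Rightarrow> 'a rel set" where
  "finer_orders A r = {r'. partial_order_on A r' \<and> r' \<subseteq> r}"

lemma finer_orders_eq: "{r'. partial_order_on A r' \<and> finer A r' r} = finer_orders A r"
  by (fastforce simp: finer_orders_def finer_def dest: partial_order_onD)

lemma finite_partial_orders: "finite A \<Longrightarrow> finite {r. partial_order_on A r}"
  by (rule finite_subset[of _ "Pow (A \<times> A)"]) (auto dest: partial_order_onD)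

lemma finite_if_partial_order_on: "finite A \<Longrightarrow> partial_order_on A r \<Longrightarrow> finite r"
  by (rule finite_subset[of _ "A \<times> A"]) (auto dest: partial_order_onD)

lemma finite_finer_orders: "finite A \<Longrightarrow> finite (finer_orders A r)"
  by (rule finite_subset[OF _ finite_partial_orders[of A]]) (auto simp: finer_orders_def)

lemma Phi_eq: "Phi A = linear_extension (\<lambda>r. \<Sum>r'\<in>finer_orders A r. basis_vec r')"
  by (simp add: Phi_def finer_orders_eq)

lemma Phi_basis_vec: "Phi A (basis_vec r) = (\<Sum>r'\<in>finer_orders A r. basis_vec r')"
  by (simp add: Phi_eq)

lemma Phi_in_poset_space: "Phi A v \<in> poset_space A"
  unfolding Phi_eq
  by (intro linear_extension_in_poset_space pm.subspace_sum subspace_poset_space)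
     (auto simp: finer_orders_def)

section \<open>Relabelling of finer orders\<close>

lemma relabel_finer_orders_subset:
  assumes "bij_betw \<sigma> A B"
  shows "relabel \<sigma> ` finer_orders A r \<subseteq> finer_orders B (relabel \<sigma> r)"
  using partial_order_on_relabel[OF _ assms]
  by (auto simp: finer_orders_def relabel_def)

lemma relabel_inverse:
  assumes "r \<subseteq> A \<times> A" and "\<And>x. x \<in> A \<Longrightarrow> \<tau> (\<sigma> x) = x"
  shows "relabel \<tau> (relabel \<sigma> r) = r"
proof -
  have "relabel \<tau> (relabel \<sigma> r) = map_prod (\<tau> \<circ> \<sigma>) (\<tau> \<circ> \<sigma>) ` r"
    by (simp add: relabel_def image_image map_prod.comp[symmetric] comp_def prod.map_comp)
  also have "\<dots> = (\<lambda>x. x) ` r"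
    using assms by (intro image_cong) auto
  finally show ?thesis by simp
qed

text \<open>Relabelling along the inverse bijection undoes relabelling along \<open>\<sigma>\<close>
  and also preserves inclusion. This reindexing gives the naturality of \<open>Phi\<close>.\<close>

lemma bij_betw_relabel_finer_orders:
  assumes \<sigma>: "bij_betw \<sigma> A B" and r: "r \<subseteq> A \<times> A"
  shows "bij_betw (relabel \<sigma>) (finer_orders A r) (finer_orders B (relabel \<sigma> r))"
proof (rule bij_betw_byWitness[where f' = "relabel (inv_into A \<sigma>)"])
  let ?\<tau> = "inv_into A \<sigma>"
  have \<tau>: "bij_betw ?\<tau> B A" using \<sigma> by (rule bij_betw_inv_into)
  have \<tau>\<sigma>: "\<And>x. x \<in> A \<Longrightarrow> ?\<tau> (\<sigma> x) = x" and \<sigma>\<tau>: "\<And>x. x \<in> B \<Longrightarrow> \<sigma> (?\<tau> x) = x"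
    using \<sigma> by (simp_all add: bij_betw_inv_into_left bij_betw_inv_into_right)
  show "\<forall>s\<in>finer_orders A r. relabel ?\<tau> (relabel \<sigma> s) = s"
  proof
    fix s assume "s \<in> finer_orders A r"
    then have "s \<subseteq> A \<times> A" using r by (auto simp: finer_orders_def)
    then show "relabel ?\<tau> (relabel \<sigma> s) = s" using \<tau>\<sigma> by (rule relabel_inverse)
  qed
  show "\<forall>s\<in>finer_orders B (relabel \<sigma> r). relabel \<sigma> (relabel ?\<tau> s) = s"
  proof
    fix s assume "s \<in> finer_orders B (relabel \<sigma> r)"
    then have "s \<subseteq> B \<times> B" by (auto simp: finer_orders_def dest: partial_order_onD)
    then show "relabel \<sigma> (relabel ?\<tau> s) = s" using \<sigma>\<tau> by (rule relabel_inverse)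
  qed
  show "relabel \<sigma> ` finer_orders A r \<subseteq> finer_orders B (relabel \<sigma> r)"
    by (rule relabel_finer_orders_subset[OF \<sigma>])
  show "relabel ?\<tau> ` finer_orders B (relabel \<sigma> r) \<subseteq> finer_orders A r"
    using relabel_finer_orders_subset[OF \<tau>, of "relabel \<sigma> r"] relabel_inverse[of r A ?\<tau> \<sigma>, OF r \<tau>\<sigma>] by simp
qed


section \<open>The automorphism\<close>

lemma endomorphism_Phi:
  "poset_species.endomorphism (Phi :: 'a set \<Rightarrow> ('a rel \<Rightarrow>\<^sub>0 'k::field) \<Rightarrow> _)"
proof -
  have "Phi B (poset_act A \<sigma> v) = poset_act A \<sigma> (Phi A v)"
    if \<sigma>: "bij_betw \<sigma> A B" and v: "v \<in> poset_space A" for A B \<sigma> and v :: "'a rel \<Rightarrow>\<^sub>0 'k"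
    unfolding Phi_eq poset_act_def linear_extension_linear_extension linear_extension_basis_vec
      linear_extension_sum
  \<comment> \<open>Both sides are now linear extensions evaluated at \<open>v\<close>, so it
    suffices to compare them on each poset in the support of \<open>v\<close>.\<close>
  proof (rule linear_extension_cong)
    fix r assume "r \<in> Poly_Mapping.keys v"
    with v have "r \<subseteq> A \<times> A"
      by (auto simp: poset_space_def dest!: partial_order_onD)
    from sum.reindex_bij_betw[OF bij_betw_relabel_finer_orders[OF \<sigma> this], of basis_vec]
    show "(\<Sum>s\<in>finer_orders B (relabel \<sigma> r). basis_vec s) =
        (\<Sum>s\<in>finer_orders A r. basis_vec (relabel \<sigma> s) :: 'a rel \<Rightarrow>\<^sub>0 'k)" by (rule sym)
  qed
  moreover have "linear_map_between pm_scale (poset_space A) (poset_space A)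
      (Phi A :: ('a rel \<Rightarrow>\<^sub>0 'k) \<Rightarrow> _)" for A
    using Phi_in_poset_space
    by (auto simp: linear_map_between_def Phi_eq linear_extension_add linear_extension_scale)
  ultimately show ?thesis
    by (simp add: poset_species.endomorphism_def)
qed

section \<open>Bijectivity of \<open>Phi\<close> on each finite set\<close>

text \<open>Unitriangularity: if \<open>r\<close> has the most pairs among the posets in the support
  of \<open>v\<close>, then \<open>r\<close> refines no other poset there, so \<open>Phi A v\<close>
  and \<open>v\<close> have the same nonzero coefficient at \<open>r\<close>.\<close>

lemma Phi_eq_0_imp_eq_0:
  fixes v :: "'a rel \<Rightarrow>\<^sub>0 'k::field"
  assumes A: "finite A" and v: "v \<in> poset_space A" and 0: "Phi A v = 0"
  shows "v = 0"
proof (rule ccontr)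
  assume "v \<noteq> 0"
  then have ne: "card ` Poly_Mapping.keys v \<noteq> {}"
    by simp
  have fin: "finite (card ` Poly_Mapping.keys v)"
    by simp
  obtain r where r: "r \<in> Poly_Mapping.keys v" and "card r = Max (card ` Poly_Mapping.keys v)"
    using Max_in[OF fin ne] by auto
  with fin have max: "card s \<le> card r" if "s \<in> Poly_Mapping.keys v" for s
    using that by simp
  \<comment> \<open>An inclusion \<open>r \<subseteq> s\<close> into a finite set with no more
    elements than \<open>r\<close> is an equality.\<close>
  have eq: "r \<in> finer_orders A s \<longleftrightarrow> s = r" if s: "s \<in> Poly_Mapping.keys v" for s
  proof -
    have "partial_order_on A s" "partial_order_on A r"
      using v r s by (auto simp: poset_space_def)
    moreover from this have "finite s"
      using finite_if_partial_order_on[OF A] by blast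
    ultimately show ?thesis
      using max[OF s] by (auto simp: finer_orders_def dest: card_seteq)
  qed
  have "Poly_Mapping.lookup (Phi A v) r = (\<Sum>s\<in>Poly_Mapping.keys v.
      Poly_Mapping.lookup v s * (if r \<in> finer_orders A s then 1 else 0))"
    using A by (simp add: Phi_eq linear_extension_def lookup_sum lookup_basis_vec
        finite_finer_orders)
  also have "\<dots> = (\<Sum>s\<in>Poly_Mapping.keys v. if s = r then Poly_Mapping.lookup v s else 0)"
    by (intro sum.cong) (auto simp: eq)
  also have "\<dots> = Poly_Mapping.lookup v r"
    using r by simp
  finally show False
    using 0 r by (simp add: in_keys_iff)
qed

text \<open>Back substitution along strict inclusion: \<open>basis_vec r\<close> is
  \<open>Phi A (basis_vec r)\<close> minus the basis vectors of the strictly finer orders, which lie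
  in the image by induction.\<close>

lemma basis_vec_in_range_Phi:
  assumes A: "finite A" and r: "partial_order_on A r"
  shows "(basis_vec r :: 'a rel \<Rightarrow>\<^sub>0 'k::field) \<in> Phi A ` poset_space A"
proof -
  have "finite r"
    using finite_if_partial_order_on A r by blast
  then show ?thesis
    using r
  proof (induction r rule: finite_psubset_induct)
    case (psubset r)
    define S where "S = finer_orders A r - {r}"
    have "\<exists>w. w \<in> poset_space A \<and> (basis_vec s :: 'a rel \<Rightarrow>\<^sub>0 'k) = Phi A w" if "s \<in> S" for s
      using psubset.IH[of s] that by (auto simp: S_def finer_orders_def)
    then obtain w where w: "\<And>s. s \<in> S \<Longrightarrow> w s \<in> poset_space A"
        "\<And>s. s \<in> S \<Longrightarrow> (basis_vec s :: 'a rel \<Rightarrow>\<^sub>0 'k) = Phi A (w s)"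
      by metis
    \<comment> \<open>The diagonal entry 1 is split off, since \<open>r\<close> refines
      itself.\<close>
    have "Phi A (basis_vec r) = basis_vec r + (\<Sum>s\<in>S. basis_vec s :: 'a rel \<Rightarrow>\<^sub>0 'k)"
      unfolding Phi_basis_vec S_def using psubset.prems A
      by (intro sum.remove) (auto simp: finite_finer_orders, simp add: finer_orders_def)
    also have "(\<Sum>s\<in>S. basis_vec s :: 'a rel \<Rightarrow>\<^sub>0 'k) = Phi A (\<Sum>s\<in>S. w s)"
      by (simp add: w(2) Phi_eq linear_extension_sum)
    finally have "basis_vec r = Phi A (basis_vec r - (\<Sum>s\<in>S. w s))"
      by (simp add: Phi_eq linear_extension_diff)
    moreover have "basis_vec r - (\<Sum>s\<in>S. w s) \<in> poset_space A"
      using w(1) psubset.prems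
      by (intro pm.subspace_diff pm.subspace_sum subspace_poset_space) auto
    ultimately show ?case by blast
  qed
qed

lemma bij_betw_Phi:
  assumes A: "finite A"
  shows "bij_betw (Phi A :: ('a rel \<Rightarrow>\<^sub>0 'k::field) \<Rightarrow> _) (poset_space A) (poset_space A)"
  unfolding bij_betw_def
proof
  show "inj_on (Phi A :: ('a rel \<Rightarrow>\<^sub>0 'k) \<Rightarrow> _) (poset_space A)"
  proof (rule inj_onI)
    fix v w :: "'a rel \<Rightarrow>\<^sub>0 'k"
    assume vw: "v \<in> poset_space A" "w \<in> poset_space A" and "Phi A v = Phi A w"
    then have "Phi A (v - w) = 0"
      by (simp add: Phi_eq linear_extension_diff)
    moreover have "v - w \<in> poset_space A"
      using vw by (intro pm.subspace_diff subspace_poset_space)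
    ultimately show "v = w"
      using Phi_eq_0_imp_eq_0[OF A, of "v - w"] by simp
  qed
  have "v \<in> Phi A ` poset_space A" if v: "v \<in> poset_space A" for v :: "'a rel \<Rightarrow>\<^sub>0 'k"
  proof -
    have "\<forall>r\<in>Poly_Mapping.keys v. \<exists>w. w \<in> poset_space A \<and> (basis_vec r :: 'a rel \<Rightarrow>\<^sub>0 'k) = Phi A w"
      using v basis_vec_in_range_Phi[OF A] unfolding poset_space_def[of A] image_iff by blast
    then obtain w where w: "\<And>r. r \<in> Poly_Mapping.keys v \<Longrightarrow> w r \<in> poset_space A"
        "\<And>r. r \<in> Poly_Mapping.keys v \<Longrightarrow> (basis_vec r :: 'a rel \<Rightarrow>\<^sub>0 'k) = Phi A (w r)"
      by metis
    \<comment> \<open>Preimages of the basis vectors in the support of \<open>v\<close>, combined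
      with the coefficients of \<open>v\<close>, form a preimage of \<open>v\<close>.\<close>
    have "Phi A (linear_extension w v) = linear_extension (\<lambda>r. Phi A (w r)) v"
      by (simp add: Phi_eq linear_extension_linear_extension)
    also have "\<dots> = linear_extension basis_vec v"
      by (rule linear_extension_cong) (simp add: w(2))
    finally have "Phi A (linear_extension w v) = v"
      by (simp add: linear_extension_id)
    moreover have "linear_extension w v \<in> poset_space A"
      by (intro linear_extension_in_poset_space w(1))
    ultimately show ?thesis by (metis imageI)
  qed
  then show "(Phi A :: ('a rel \<Rightarrow>\<^sub>0 'k) \<Rightarrow> _) ` poset_space A = poset_space A"
    using Phi_in_poset_space by blast
qed


section \<open>The compositions\<close>

text \<open>The order on \<open>A\<close> that \<open>Omega\<close> compares with \<open>rA\<close>: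
  the collapsed block \<open>None\<close> is renamed to \<open>a\<close>.\<close>

definition graft_quotient :: "'a set \<Rightarrow> 'a \<Rightarrow> 'a set \<Rightarrow> 'a rel \<Rightarrow> 'a rel" where
  "graft_quotient A a B r = relabel (case_option a id) (quotient_order (graft_set A a B) r B)"

text \<open>In this form \<open>r\<close> visibly determines \<open>rA\<close> and
  \<open>rB\<close>, so different pairs have disjoint \<open>Omega\<close> sets.\<close>

lemma Omega_eq:
  "Omega A rA a B rB = {r. partial_order_on (graft_set A a B) r \<and>
     convex_in (graft_set A a B) r B \<and> graft_quotient A a B r = rA \<and> r \<inter> (B \<times> B) = rB}"
  by (auto simp: Omega_def graft_quotient_def)

text \<open>The four clauses of the quotient merge into two: a direct relation away from
  \<open>a\<close>, or a passage through the block, where being equal to \<open>a\<close> counts as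
  having reached it.\<close>

lemma graft_quotient_iff:
  assumes "a \<in> A" "A \<inter> B = {}"
  shows "(x, y) \<in> graft_quotient A a B r \<longleftrightarrow> x \<in> A \<and> y \<in> A \<and>
    (x \<noteq> a \<and> y \<noteq> a \<and> (x, y) \<in> r \<or>
     (x = a \<or> (\<exists>b\<in>B. (x, b) \<in> r)) \<and> (y = a \<or> (\<exists>b\<in>B. (b, y) \<in> r)))"
proof -
  have diff: "graft_set A a B - B = A - {a}"
    using assms by (auto simp: graft_set_def)
  have "(x, y) \<in> graft_quotient A a B r \<longleftrightarrow> (\<exists>p q.
      x = case_option a id p \<and> y = case_option a id q \<and>
      (p, q) \<in> quotient_order (graft_set A a B) r B)"
    by (force simp: graft_quotient_def relabel_def)
  also have "\<dots> \<longleftrightarrow>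
      x = a \<and> y = a \<or>
      x = a \<and> y \<in> A - {a} \<and> (\<exists>b\<in>B. (b, y) \<in> r) \<or>
      x \<in> A - {a} \<and> y = a \<and> (\<exists>b\<in>B. (x, b) \<in> r) \<or>
      x \<in> A - {a} \<and> y \<in> A - {a} \<and>
        ((x, y) \<in> r \<or> (\<exists>b\<in>B. \<exists>b'\<in>B. (x, b) \<in> r \<and> (b', y) \<in> r))"
    unfolding quotient_order_def diff split_option_ex by (simp, blast)
  finally show ?thesis
    using assms(1) by blast
qed

section \<open>Orders finer than \<open>bullet\<close>\<close>

text \<open>Each kind of pair in \<open>r\<close> is visible either in the quotient or in the
  restriction to \<open>B\<close>. Conversely, the pairs that the quotient adds by passing through
  the block lie in \<open>rA\<close> by transitivity through \<open>a\<close>.\<close>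

lemma subset_bullet_iff:
  assumes rA: "partial_order_on A rA" and dis: "A \<inter> B = {}" and a: "a \<in> A"
    and r: "r \<subseteq> graft_set A a B \<times> graft_set A a B"
  shows "r \<subseteq> bullet A rA a B rB \<longleftrightarrow> graft_quotient A a B r \<subseteq> rA \<and> r \<inter> (B \<times> B) \<subseteq> rB"
proof (intro iffI conjI)
  assume sub: "r \<subseteq> bullet A rA a B rB"
  have "(a, a) \<in> rA" "trans rA"
    using partial_order_onD[OF rA] a by (auto simp: refl_on_def)
  show "graft_quotient A a B r \<subseteq> rA"
  proof (rule subrelI)
    have xa: "(x, a) \<in> rA" if "x \<in> A - {a}" "b \<in> B" "(x, b) \<in> r" for x b
      using that sub dis by (auto simp: bullet_def)
    have ay: "(a, y) \<in> rA" if "y \<in> A - {a}" "b \<in> B" "(b, y) \<in> r" for y b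
      using that sub dis by (auto simp: bullet_def)
    have xy: "(x, y) \<in> rA" if "x \<in> A - {a}" "y \<in> A - {a}" "(x, y) \<in> r" for x y
      using that sub dis by (auto simp: bullet_def)
    fix x y assume "(x, y) \<in> graft_quotient A a B r"
    then show "(x, y) \<in> rA"
      unfolding graft_quotient_iff[OF a dis]
      using \<open>(a, a) \<in> rA\<close> xa ay xy transD[OF \<open>trans rA\<close>, of x a y] by blast
  qed
  show "r \<inter> (B \<times> B) \<subseteq> rB"
    using sub dis by (auto simp: bullet_def)
next
  assume *: "graft_quotient A a B r \<subseteq> rA \<and> r \<inter> (B \<times> B) \<subseteq> rB"
  then have sub: "(u, v) \<in> rA" if "(u, v) \<in> graft_quotient A a B r" for u v
    using that by blast
  show "r \<subseteq> bullet A rA a B rB"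
  proof (rule subrelI)
    fix x y assume xy: "(x, y) \<in> r"
    then have "x \<in> graft_set A a B" "y \<in> graft_set A a B"
      using r by auto
    moreover have "(x, y) \<in> rA" if "x \<in> A - {a}" "y \<in> A - {a}"
      by (rule sub) (use that xy in \<open>auto simp: graft_quotient_iff[OF a dis]\<close>)
    moreover have "(x, a) \<in> rA" if "x \<in> A - {a}" "y \<in> B"
      by (rule sub) (use that xy a in \<open>auto simp: graft_quotient_iff[OF a dis]\<close>)
    moreover have "(a, y) \<in> rA" if "x \<in> B" "y \<in> A - {a}"
      by (rule sub) (use that xy a in \<open>auto simp: graft_quotient_iff[OF a dis]\<close>)
    moreover have "(x, y) \<in> rB" if "x \<in> B" "y \<in> B"
      using * that xy by blast
    ultimately show "(x, y) \<in> bullet A rA a B rB"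
      unfolding graft_set_def bullet_def by blast
  qed
qed

lemma convex_in_if_subset_bullet:
  assumes rA: "partial_order_on A rA" and dis: "A \<inter> B = {}" and a: "a \<in> A"
    and sub: "r \<subseteq> bullet A rA a B rB"
  shows "convex_in (graft_set A a B) r B"
  unfolding convex_in_def
proof (intro conjI ballI impI)
  show "B \<subseteq> graft_set A a B" by (simp add: graft_set_def)
  fix x y z assume "x \<in> B" "y \<in> B" "z \<in> graft_set A a B" and xzy: "(x, z) \<in> r \<and> (z, y) \<in> r"
  show "z \<in> B"
  proof (rule ccontr)
    assume "z \<notin> B"
    with \<open>z \<in> graft_set A a B\<close> have "z \<in> A - {a}" by (auto simp: graft_set_def)
    moreover from this have "(a, z) \<in> rA" "(z, a) \<in> rA"
      using xzy sub \<open>x \<in> B\<close> \<open>y \<in> B\<close> dis by (auto simp: bullet_def)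
    ultimately show False
      using partial_order_onD(3)[OF rA] by (auto dest: antisymD)
  qed
qed

text \<open>Antisymmetry, the delicate axiom for a quotient, is inherited from \<open>rA\<close> by
  inclusion.\<close>

lemma partial_order_on_graft_quotient:
  assumes rA: "partial_order_on A rA" and dis: "A \<inter> B = {}" and a: "a \<in> A"
    and r: "partial_order_on (graft_set A a B) r" and sub: "graft_quotient A a B r \<subseteq> rA"
  shows "partial_order_on A (graft_quotient A a B r)"
proof -
  note iff = graft_quotient_iff[OF a dis]
  have refl: "refl_on (graft_set A a B) r" and tr: "trans r"
    using partial_order_onD[OF r] by auto
  have "graft_quotient A a B r \<subseteq> A \<times> A"
    using sub partial_order_onD(4)[OF rA] by blast
  moreover have "refl_on A (graft_quotient A a B r)"
    using refl by (auto simp: refl_on_def iff graft_set_def)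
  moreover have "antisym (graft_quotient A a B r)"
    using partial_order_onD(3)[OF rA] sub by (rule antisym_subset[rotated])
  moreover have "trans (graft_quotient A a B r)"
  proof (rule transI)
    fix x y z assume "(x, y) \<in> graft_quotient A a B r" "(y, z) \<in> graft_quotient A a B r"
    then show "(x, z) \<in> graft_quotient A a B r"
      \<comment> \<open>A direct step before or after a passage through the block is absorbed by
        transitivity of \<open>r\<close>; two passages collapse into one, from the first entry to
        the last exit.\<close>
      unfolding iff using transD[OF tr, of x y] transD[OF tr, of _ y z] by blast
  qed
  ultimately show ?thesis
    by (simp add: partial_order_on_def preorder_on_def)
qed

lemma partial_order_on_Int_Times:
  assumes "partial_order_on P r" and "B \<subseteq> P"
  shows "partial_order_on B (r \<inter> (B \<times> B))"
proof -
  have "trans (r \<inter> (B \<times> B))"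
    using partial_order_onD[OF assms(1)] by (intro trans_Int) (auto simp: trans_def)
  then show ?thesis
    using assms(2) partial_order_onD[OF assms(1)]
    by (auto simp: partial_order_on_def preorder_on_def refl_on_def antisym_def)
qed

text \<open>The orders finer than \<open>bullet\<close> are grouped by the map \<open>?g\<close> to
  quotient and restriction. Its fibres are the \<open>Omega\<close> sets, and summing over them is
  the bilinear expansion of \<open>circ\<close>.\<close>

lemma Phi_bullet:
  fixes A B :: "'a set"
  assumes A: "finite A" and B: "finite B" and dis: "A \<inter> B = {}" and a: "a \<in> A"
    and rA: "partial_order_on A rA"
  shows "Phi (graft_set A a B) (basis_vec (bullet A rA a B rB) :: 'a rel \<Rightarrow>\<^sub>0 'k::field) =
    circ A a B (Phi A (basis_vec rA)) (Phi B (basis_vec rB))"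
proof -
  let ?P = "graft_set A a B"
  let ?S = "finer_orders ?P (bullet A rA a B rB)"
  let ?T = "finer_orders A rA \<times> finer_orders B rB"
  let ?g = "\<lambda>r. (graft_quotient A a B r, r \<inter> (B \<times> B))"
  have finP: "finite ?P" using A B by (simp add: graft_set_def)
  have S_iff: "r \<in> ?S \<longleftrightarrow> partial_order_on ?P r \<and>
      graft_quotient A a B r \<subseteq> rA \<and> r \<inter> (B \<times> B) \<subseteq> rB" for r
    using subset_bullet_iff[OF rA dis a, of r rB] partial_order_onD(4)[of ?P r]
    unfolding finer_orders_def by blast
  have maps: "?g ` ?S \<subseteq> ?T"
    using partial_order_on_graft_quotient[OF rA dis a] partial_order_on_Int_Times[of ?P _ B]
    unfolding image_subset_iff Ball_def S_iff mem_Times_iff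
    by (simp add: finer_orders_def graft_set_def)
  \<comment> \<open>Convexity is the one clause of \<open>Omega\<close> absent from
    \<open>S_iff\<close>, and it holds on \<open>?S\<close>. Conversely, \<open>t \<in> ?T\<close>
    supplies the inclusions that place a member of \<open>Omega\<close> in
    \<open>?S\<close>.\<close>
  have fibre: "{r \<in> ?S. ?g r = t} = Omega A (fst t) a B (snd t)" if "t \<in> ?T" for t
  proof -
    have "convex_in ?P r B" if "r \<in> ?S" for r
      using that convex_in_if_subset_bullet[OF rA dis a] by (auto simp: finer_orders_def)
    with \<open>t \<in> ?T\<close> show ?thesis
      unfolding Omega_eq S_iff by (cases t) (auto simp: finer_orders_def)
  qed
  have "circ A a B (Phi A (basis_vec rA)) (Phi B (basis_vec rB)) =
      (\<Sum>sA\<in>finer_orders A rA. \<Sum>sB\<in>finer_orders B rB. \<Sum>r\<in>Omega A sA a B sB.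
        basis_vec r :: 'a rel \<Rightarrow>\<^sub>0 'k)"
    by (simp add: circ_def bilinear_extension_def Phi_basis_vec linear_extension_sum)
  also have "\<dots> = (\<Sum>t\<in>?T. \<Sum>r\<in>Omega A (fst t) a B (snd t). basis_vec r)"
    by (simp add: sum.cartesian_product case_prod_unfold)
  also have "\<dots> = (\<Sum>t\<in>?T. \<Sum>r\<in>{r \<in> ?S. ?g r = t}. basis_vec r)"
    by (rule sum.cong) (simp_all only: fibre)
  also have "\<dots> = (\<Sum>r\<in>?S. basis_vec r)"
    using A B finP maps by (intro sum.group) (auto simp: finite_finer_orders)
  finally show ?thesis
    by (simp add: Phi_basis_vec)
qed

theorem mainTheorem5:
  shows "linear_species.automorphism
           (pm_scale :: 'k::field \<Rightarrow> ('a rel \<Rightarrow>\<^sub>0 'k) \<Rightarrow> ('a rel \<Rightarrow>\<^sub>0 'k)) poset_space poset_act Phi \<and>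
         (\<forall>(A :: 'a set) rA (B :: 'a set) rB. \<forall>a\<in>A.
            finite A \<and> A \<noteq> {} \<and> finite B \<and> B \<noteq> {} \<and> A \<inter> B = {} \<and>
            partial_order_on A rA \<and> partial_order_on B rB \<longrightarrow>
            Phi (graft_set A a B) (basis_vec (bullet A rA a B rB) :: 'a rel \<Rightarrow>\<^sub>0 'k) =
              circ A a B (Phi A (basis_vec rA)) (Phi B (basis_vec rB)))"
proof (intro conjI allI ballI impI)
  show "poset_species.automorphism (Phi :: 'a set \<Rightarrow> ('a rel \<Rightarrow>\<^sub>0 'k) \<Rightarrow> _)"
    by (rule poset_species.automorphism_if_bij_betw[OF endomorphism_Phi bij_betw_Phi])
qed (auto intro!: Phi_bullet)

end
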